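(* Let $\Omega\subseteq\mathbb{R}^n$ be a closed convex set, $\theta:\mathbb{R}^n\to\mathbb{R}$ a closed proper convex function, and $F:\mathbb{R}^n\to\mathbb{R}^n$ a monotone mapping. Let $\Omega^*$ be the set of solutions of the mixed variational inequality problem: find $w^*\in\Omega$ such that $$\theta(w)-\theta(w^* )+\langle w-w^*,F(w^* )\rangle\ge 0\quad\text{for all } w\in\Omega .$$ Let $G\in S^n_+$ and assume: (i) $\Omega^*$ is nonempty; (ii) $F$ is $H$-monotone for some $H\in S^n_+$, i.e. $\langle u-v,F(u)-F(v)\rangle\ge\|u-v\|_H^2$ for all $u,v\in\mathbb{R}^n$; (iii) $M:=G+H\in S^n_{++}$. Let $\{\alpha_k\}_{k=0}^\infty$ and $\{\lambda_k\}_{k=0}^\infty$ be sequences of real numbers such that, for all $k$, $0\le\alpha_k\le\alpha_{k+1}\le\alpha<\tfrac13$ and $\lambda_k\ge\lambda$ for some $\lambda>0$ (with $\alpha,\lambda$ independent of $k$). Let $\{w^k\}_{k=0}^\infty$ be the sequence generated, together with $\{\bar w^k\}_{k=0}^\infty$, by the general inertial proximal point method with these data (defined in the context). Then: 1. $\{w^k\}_{k=0}^\infty$ converges to some point in $\Omega^*$ as $k\to\infty$. 2. For any $w^*\in\Omega^*$ and any positive integer $k$, $$\min_{0\le i\le k-1}\|w^{i+1}-\bar w^i\|_G^2\le\frac{\left(1+\frac{2}{1-3\alpha}\right)\|w^0-w^*\|_G^2}{k}.$$ Moreover, as $k\to\infty$, $$\min_{0\le i\le k-1}\|w^{i+1}-\bar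 w^i\|_G^2=o\!\left(\frac1k\right).$$
   Context: $S^n_+$ and $S^n_{++}$ denote the sets of symmetric positive semidefinite and symmetric positive definite real $n\times n$ matrices. For $A\in S^n_+$ and $u,v\in\mathbb{R}^n$, $\langle u,v\rangle_A:=u^TAv$ and $\|u\|_A:=\sqrt{\langle u,u\rangle_A}$. $\langle\cdot,\cdot\rangle$ is the standard inner product. General inertial proximal point method: given any $w^0=w^{-1}\in\mathbb{R}^n$, for $k=0,1,2,\dots$ set $$\bar w^k:=w^k+\alpha_k(w^k-w^{k-1}),$$ and find $w^{k+1}\in\Omega$ such that $$\theta(w)-\theta(w^{k+1})+\big\langle w-w^{k+1},\,F(w^{k+1})+\lambda_k^{-1}G(w^{k+1}-\bar w^k)\big\rangle\ge0\quad\text{for all } w\in\Omega .$$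
   Formalization: In part 1, that the limit of w^k lies in Ω* is proved only for F continuous on Ω (for discontinuous monotone F it can fail); convergence of w^k and all of part 2 are proved without continuity. *)

theory Defs
  imports "HOL-Analysis.Analysis" "HOL-Library.Landau_Symbols"
begin

definition sym_matrix :: "real ^ 'n ^ 'n \<Rightarrow> bool" where
  "sym_matrix A \<longleftrightarrow> transpose A = A"

definition psd_matrix :: "real ^ 'n ^ 'n \<Rightarrow> bool" where
  "psd_matrix A \<longleftrightarrow> sym_matrix A \<and> (\<forall>x. 0 \<le> x \<bullet> (A *v x))"

definition pd_matrix :: "real ^ 'n ^ 'n \<Rightarrow> bool" where
  "pd_matrix A \<longleftrightarrow> sym_matrix A \<and> (\<forall>x. x \<noteq> 0 \<longrightarrow> 0 < x \<bullet> (A *v x))"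

definition mat_inner :: "real ^ 'n ^ 'n \<Rightarrow> real ^ 'n \<Rightarrow> real ^ 'n \<Rightarrow> real" where
  "mat_inner A u v = u \<bullet> (A *v v)"

definition mat_norm :: "real ^ 'n ^ 'n \<Rightarrow> real ^ 'n \<Rightarrow> real" where
  "mat_norm A u = sqrt (mat_inner A u u)"

text \<open>
  Properness is built into the type, since the function takes finite values everywhere.
  Closedness means, as usual in convex analysis, that the epigraph is closed.
\<close>
definition closed_proper_convex :: "(real ^ 'n \<Rightarrow> real) \<Rightarrow> bool" where
  "closed_proper_convex \<theta> \<longleftrightarrow> convex_on UNIV \<theta> \<and> closed (epigraph UNIV \<theta>)"

definition monotone_operator :: "(real ^ 'n \<Rightarrow> real ^ 'n) \<Rightarrow> bool" where
  "monotone_operator F \<longleftrightarrow> (\<forall>u v. 0 \<le> (u - v) \<bullet> (F u - F v))"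

definition H_monotone :: "real ^ 'n ^ 'n \<Rightarrow> (real ^ 'n \<Rightarrow> real ^ 'n) \<Rightarrow> bool" where
  "H_monotone H F \<longleftrightarrow> (\<forall>u v. (mat_norm H (u - v))\<^sup>2 \<le> (u - v) \<bullet> (F u - F v))"

text \<open>
  A monotone \<open>F\<close> may be discontinuous, and then this set need not be closed: for \<open>\<Omega> = \<real>\<close>,
  \<open>\<theta> = 0\<close> and \<open>F\<close> equal to \<open>-1\<close> on \<open>x \<le> 0\<close> and \<open>0\<close> on \<open>x > 0\<close> it is the open half-line. Inertial
  iterates can converge to such a missing limit point.
\<close>
definition mvi_solutions ::
  "(real ^ 'n) set \<Rightarrow> (real ^ 'n \<Rightarrow> real) \<Rightarrow> (real ^ 'n \<Rightarrow> real ^ 'n) \<Rightarrow> (real ^ 'n) set" where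
  "mvi_solutions \<Omega> \<theta> F =
     {ws \<in> \<Omega>. \<forall>w\<in>\<Omega>. 0 \<le> \<theta> w - \<theta> ws + (w - ws) \<bullet> F ws}"

text \<open>
  A pair of sequences \<open>w\<close>, \<open>wbar\<close> is a run of the general inertial proximal point method.
  The initialisation, in which the iterate with index \<open>-1\<close> equals \<open>w 0\<close>, is encoded by truncated
  subtraction: for \<open>k = 0\<close> the term \<open>w (k - 1)\<close> is \<open>w 0\<close>. The starting point \<open>w 0\<close> need not
  lie in \<open>\<Omega>\<close>.
\<close>
definition inertial_ppm ::
  "(real ^ 'n) set \<Rightarrow> (real ^ 'n \<Rightarrow> real) \<Rightarrow> (real ^ 'n \<Rightarrow> real ^ 'n) \<Rightarrow> real ^ 'n ^ 'n \<Rightarrow>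
   (nat \<Rightarrow> real) \<Rightarrow> (nat \<Rightarrow> real) \<Rightarrow> (nat \<Rightarrow> real ^ 'n) \<Rightarrow> (nat \<Rightarrow> real ^ 'n) \<Rightarrow> bool" where
  "inertial_ppm \<Omega> \<theta> F G \<alpha> lam w wbar \<longleftrightarrow>
     (\<forall>k. wbar k = w k + \<alpha> k *\<^sub>R (w k - w (k - 1)) \<and>
          w (Suc k) \<in> \<Omega> \<and>
          (\<forall>v\<in>\<Omega>. 0 \<le> \<theta> v - \<theta> (w (Suc k)) +
             (v - w (Suc k)) \<bullet> (F (w (Suc k)) + inverse (lam k) *\<^sub>R (G *v (w (Suc k) - wbar k)))))"

end

theory Submission
  imports Defs
begin

text \<open>
  Adding the proximal inequality at a solution \<open>p\<close> to the variational inequality of \<open>p\<close> shows that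
  \<open>\<phi> k = \<parallel>w k - p\<parallel>\<^sub>G\<^sup>2\<close> obeys a second-order recursion in which
  \<open>\<phi> k - \<alpha> k * \<phi> (k - 1) + 2 * \<alpha> k * \<parallel>w k - w (k - 1)\<parallel>\<^sub>G\<^sup>2\<close> decreases. This makes the squared residuals
  \<open>\<parallel>w (k + 1) - wbar k\<parallel>\<^sub>G\<^sup>2\<close> and the \<open>\<parallel>w (k + 1) - p\<parallel>\<^sub>H\<^sup>2\<close> summable and \<open>\<phi>\<close> convergent, hence so is
  \<open>\<parallel>w k - p\<parallel>\<^sup>2\<close> in the norm of \<open>G + H\<close>. The estimate only uses the inequality of \<open>p\<close> at points
  \<open>v\<close> with \<open>F\<close> evaluated at \<open>v\<close>, so it also holds for solutions of the Minty inequality. Every cluster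
  point of \<open>w\<close> is one, and taking it as \<open>p\<close> forces \<open>w\<close> to converge to it.
\<close>

subsection \<open>Semi-inner products of positive semidefinite matrices\<close>

lemma mat_inner_add_left: "mat_inner A (x + y) z = mat_inner A x z + mat_inner A y z"
  by (simp add: mat_inner_def inner_add_left)

lemma mat_inner_add_right: "mat_inner A z (x + y) = mat_inner A z x + mat_inner A z y"
  by (simp add: mat_inner_def inner_add_right matrix_vector_right_distrib)

lemma mat_inner_diff_left: "mat_inner A (x - y) z = mat_inner A x z - mat_inner A y z"
  by (simp add: mat_inner_def inner_diff_left)

lemma mat_inner_diff_right: "mat_inner A z (x - y) = mat_inner A z x - mat_inner A z y"
  by (simp add: mat_inner_def inner_diff_right matrix_vector_mult_diff_distrib)

lemma mat_inner_scaleR_left: "mat_inner A (c *\<^sub>R x) z = c * mat_inner A x z"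
  by (simp add: mat_inner_def)

lemma mat_inner_scaleR_right: "mat_inner A z (c *\<^sub>R x) = c * mat_inner A z x"
  by (simp add: mat_inner_def matrix_vector_mult_scaleR)

lemma mat_inner_zero_left: "mat_inner A 0 z = 0"
  by (simp add: mat_inner_def)

lemma mat_inner_matrix_add: "mat_inner (A + B) x y = mat_inner A x y + mat_inner B x y"
  by (simp add: mat_inner_def matrix_vector_mult_add_rdistrib inner_add_right)

lemmas mat_inner_bilinear =
  mat_inner_add_left mat_inner_add_right mat_inner_diff_left mat_inner_diff_right
  mat_inner_scaleR_left mat_inner_scaleR_right

lemma sym_matrix_inner_commute:
  assumes "sym_matrix A"
  shows "mat_inner A x y = mat_inner A y x"
  using assms unfolding mat_inner_def sym_matrix_def
  by (metis dot_lmul_matrix inner_commute transpose_matrix_vector)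

lemma psd_matrix_commute: "psd_matrix A \<Longrightarrow> mat_inner A x y = mat_inner A y x"
  by (simp add: psd_matrix_def sym_matrix_inner_commute)

lemma psd_matrix_nonneg: "psd_matrix A \<Longrightarrow> 0 \<le> mat_inner A x x"
  by (simp add: psd_matrix_def mat_inner_def)

lemma psd_matrix_norm_power2: "psd_matrix A \<Longrightarrow> (mat_norm A x)\<^sup>2 = mat_inner A x x"
  by (simp add: mat_norm_def psd_matrix_nonneg)

lemma tendsto_mat_inner [tendsto_intros]:
  assumes "(f \<longlongrightarrow> x) T" "(g \<longlongrightarrow> y) T"
  shows "((\<lambda>t. mat_inner A (f t) (g t)) \<longlongrightarrow> mat_inner A x y) T"
  unfolding mat_inner_def
  by (intro tendsto_inner assms bounded_linear.tendsto[OF matrix_vector_mul_bounded_linear])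

text \<open>A semidefinite form may vanish on nonzero vectors, so the usual division by
  \<open>mat_inner A y y\<close> needs a separate degenerate case.\<close>

lemma psd_matrix_Cauchy_Schwarz:
  assumes "psd_matrix A"
  shows "(mat_inner A x y)\<^sup>2 \<le> mat_inner A x x * mat_inner A y y"
proof (cases "mat_inner A y y = 0")
  case True
  \<comment> \<open>With \<open>mat_inner A y y = 0\<close> the quadratic in \<open>s\<close>
    becomes affine, and an affine function bounded below on the whole line has slope zero. The value
    of \<open>s\<close> chosen below makes it \<open>-1\<close>.\<close>
  have nonneg: "0 \<le> mat_inner A x x - 2 * s * mat_inner A x y" for s
    using psd_matrix_nonneg[OF assms, of "x - s *\<^sub>R y"] psd_matrix_commute[OF assms, of x y] True
    by (simp add: mat_inner_bilinear algebra_simps)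
  have "mat_inner A x y = 0"
  proof (rule ccontr)
    assume ne: "mat_inner A x y \<noteq> 0"
    show False
      using nonneg[of "(mat_inner A x x + 1) / (2 * mat_inner A x y)"] ne by simp
  qed
  then show ?thesis
    using True by simp
next
  case False
  define a b c where "a = mat_inner A x x" and "b = mat_inner A x y" and "c = mat_inner A y y"
  have "c > 0"
    using False psd_matrix_nonneg[OF assms, of y] by (simp add: c_def)
  \<comment> \<open>This vector is \<open>c\<close> times the component of \<open>x\<close>
    orthogonal to \<open>y\<close>; the scaling avoids quotients.\<close>
  have "0 \<le> mat_inner A (c *\<^sub>R x - b *\<^sub>R y) (c *\<^sub>R x - b *\<^sub>R y)"
    by (rule psd_matrix_nonneg[OF assms])
  also have "\<dots> = c * (a * c - b\<^sup>2)"
    using psd_matrix_commute[OF assms, of x y]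
    by (simp add: mat_inner_bilinear a_def b_def c_def power2_eq_square algebra_simps)
  finally have "0 \<le> a * c - b\<^sup>2"
    using \<open>c > 0\<close> by (simp add: zero_le_mult_iff)
  then show ?thesis
    by (simp add: a_def b_def c_def)
qed

text \<open>The constant is the minimum of the quadratic form on the compact unit sphere;
  homogeneity carries the bound to all vectors.\<close>

lemma pd_matrix_coercive:
  fixes A :: "real ^ 'n ^ 'n"
  assumes "pd_matrix A"
  obtains c where "c > 0" "\<And>x. c * (norm x)\<^sup>2 \<le> mat_inner A x x"
proof -
  let ?S = "sphere (0 :: real ^ 'n) 1"
  have "continuous_on ?S (\<lambda>x. mat_inner A x x)"
    unfolding continuous_on_def by (intro ballI tendsto_mat_inner tendsto_ident_at)
  moreover have "axis undefined 1 \<in> ?S"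
    by (simp add: norm_axis_1)
  then have "?S \<noteq> {}" by blast
  ultimately obtain z where z: "z \<in> ?S" "\<And>x. x \<in> ?S \<Longrightarrow> mat_inner A z z \<le> mat_inner A x x"
    using continuous_attains_inf[of ?S "\<lambda>x. mat_inner A x x"] by auto
  have "z \<noteq> 0"
    using z(1) by auto
  then have pos: "mat_inner A z z > 0"
    using assms by (simp add: pd_matrix_def mat_inner_def)
  have bound: "mat_inner A z z * (norm x)\<^sup>2 \<le> mat_inner A x x" for x
  proof (cases "x = 0")
    case False
    have x: "x = norm x *\<^sub>R sgn x"
      using False by (simp add: sgn_div_norm)
    have "mat_inner A x x = mat_inner A (sgn x) (sgn x) * (norm x)\<^sup>2"
      by (subst x, subst (2) x, simp only: mat_inner_scaleR_left mat_inner_scaleR_right)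
        (simp add: power2_eq_square)
    moreover have "mat_inner A z z \<le> mat_inner A (sgn x) (sgn x)"
      using False by (intro z) (simp add: norm_sgn)
    ultimately show ?thesis
      by (simp add: mult_right_mono)
  qed (simp add: mat_inner_def)
  from that[OF pos bound] show thesis .
qed

section \<open>Quadratic identities behind the proximal and extrapolation steps\<close>

lemma psd_matrix_diff_le:
  assumes "psd_matrix A"
  shows "mat_inner A (x - y) (x - y) \<le> 2 * mat_inner A x x + 2 * mat_inner A y y"
  using psd_matrix_nonneg[OF assms, of "x + y"] by (simp add: mat_inner_bilinear)

text \<open>Used with \<open>d\<close> the new iterate, \<open>b\<close> the extrapolated point and
  \<open>p\<close> a comparison point, to turn the proximal term into squared distances.\<close>

lemma mat_inner_polarization:
  assumes "psd_matrix A"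
  shows "2 * mat_inner A (p - d) (d - b) =
    mat_inner A (b - p) (b - p) - mat_inner A (d - p) (d - p) - mat_inner A (d - b) (d - b)"
  using psd_matrix_commute[OF assms, of p d] psd_matrix_commute[OF assms, of p b]
    psd_matrix_commute[OF assms, of b d]
  by (simp add: mat_inner_bilinear)

text \<open>Here \<open>b - p\<close> is the affine combination of \<open>x - p\<close> and
  \<open>y - p\<close> with weights \<open>1 + t\<close> and \<open>-t\<close>.\<close>

lemma mat_inner_extrapolation:
  assumes "psd_matrix A" "b = x + t *\<^sub>R (x - y)"
  shows "mat_inner A (b - p) (b - p) =
    (1 + t) * mat_inner A (x - p) (x - p) - t * mat_inner A (y - p) (y - p) +
    t * (1 + t) * mat_inner A (x - y) (x - y)"
  using psd_matrix_commute[OF assms(1), of p x] psd_matrix_commute[OF assms(1), of p y]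
    psd_matrix_commute[OF assms(1), of y x]
  by (simp add: assms(2) mat_inner_bilinear algebra_simps)

text \<open>The gap between the two sides is exactly \<open>t\<close> times the squared seminorm of
  \<open>(d - x) - (x - y)\<close>.\<close>

lemma mat_inner_extrapolation_ge:
  assumes "psd_matrix A" "b = x + t *\<^sub>R (x - y)" "0 \<le> t"
  shows "(1 - t) * (mat_inner A (d - x) (d - x) - t * mat_inner A (x - y) (x - y))
    \<le> mat_inner A (d - b) (d - b)"
proof -
  define u v where "u = d - x" and "v = x - y"
  have "d - b = u - t *\<^sub>R v"
    by (simp add: u_def v_def assms(2))
  then have "mat_inner A (d - b) (d - b) - (1 - t) * (mat_inner A u u - t * mat_inner A v v)
      = t * mat_inner A (u - v) (u - v)"
    using psd_matrix_commute[OF assms(1), of v u]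
    by (simp only: mat_inner_bilinear) (simp add: algebra_simps)
  moreover have "0 \<le> t * mat_inner A (u - v) (u - v)"
    by (intro mult_nonneg_nonneg psd_matrix_nonneg assms)
  ultimately show ?thesis
    unfolding u_def[symmetric] v_def[symmetric] by linarith
qed

subsection \<open>Inertial recursions for real sequences\<close>

text \<open>The positive parts \<open>\<psi>\<close> of the increments satisfy a contraction with
  summable perturbation, so they are summable. Subtracting their partial sums from
  \<open>\<phi>\<close> leaves a decreasing sequence that is bounded below.\<close>

lemma inertial_convergent:
  fixes \<phi> \<alpha> s :: "nat \<Rightarrow> real"
  assumes \<phi>: "\<And>k. 0 \<le> \<phi> k" and \<alpha>: "\<And>k. 0 \<le> \<alpha> k" "\<And>k. \<alpha> k \<le> a" "a < 1"
    and s: "\<And>k. 0 \<le> s k" "summable s"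
    and step: "\<And>k. \<phi> (Suc k) - \<phi> k \<le> \<alpha> k * (\<phi> k - \<phi> (k - 1)) + s k"
  shows "convergent \<phi>"
proof -
  define \<psi> where "\<psi> k = max 0 (\<phi> k - \<phi> (k - 1))" for k
  have \<psi>_nonneg: "0 \<le> \<psi> k" for k
    by (simp add: \<psi>_def)
  have \<psi>_Suc: "\<psi> (Suc k) \<le> a * \<psi> k + s k" for k
  proof -
    have "\<alpha> k * (\<phi> k - \<phi> (k - 1)) \<le> \<alpha> k * \<psi> k"
      by (intro mult_left_mono \<alpha>) (simp add: \<psi>_def)
    also have "\<dots> \<le> a * \<psi> k"
      by (intro mult_right_mono \<alpha> \<psi>_nonneg)
    finally have "\<phi> (Suc k) - \<phi> k \<le> a * \<psi> k + s k"
      using step[of k] by simp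
    moreover have "0 \<le> a * \<psi> k + s k"
      using \<alpha>(1)[of 0] \<alpha>(2)[of 0] \<psi>_nonneg s(1) by (intro add_nonneg_nonneg mult_nonneg_nonneg) auto
    ultimately show ?thesis
      by (simp add: \<psi>_def)
  qed
  have "(\<Sum>i<n. \<psi> i) \<le> suminf s / (1 - a)" for n
  proof -
    have "(\<Sum>i<n. \<psi> i) \<le> (\<Sum>i<Suc n. \<psi> i)"
      by (simp add: \<psi>_nonneg)
    \<comment> \<open>Dropping the first term is free: \<open>0 - 1 = 0\<close> on naturals, hence
      \<open>\<psi> 0 = 0\<close>.\<close>
    also have "\<dots> = (\<Sum>i<n. \<psi> (Suc i))"
      by (subst sum.lessThan_Suc_shift) (simp add: \<psi>_def)
    also have "\<dots> \<le> (\<Sum>i<n. a * \<psi> i + s i)"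
      by (intro sum_mono \<psi>_Suc)
    also have "\<dots> = a * (\<Sum>i<n. \<psi> i) + (\<Sum>i<n. s i)"
      by (simp add: sum.distrib sum_distrib_left)
    also have "(\<Sum>i<n. s i) \<le> suminf s"
      by (intro sum_le_suminf s) auto
    finally show ?thesis
      using \<open>a < 1\<close> by (simp add: field_simps)
  qed
  then have "summable \<psi>"
    by (intro summableI_nonneg_bounded \<psi>_nonneg)
  have "summable (\<lambda>k. \<psi> (Suc k))"
    using \<open>summable \<psi>\<close> by (simp add: summable_Suc_iff)
  then have conv: "convergent (\<lambda>n. \<Sum>i<n. \<psi> (Suc i))"
    by (simp add: summable_iff_convergent)
  let ?d = "\<lambda>n. \<phi> n - (\<Sum>i<n. \<psi> (Suc i))"
  have "decseq ?d"
    by (rule decseq_SucI) (simp add: \<psi>_def)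
  moreover have "- suminf (\<lambda>k. \<psi> (Suc k)) \<le> ?d n" for n
    using sum_le_suminf[OF \<open>summable (\<lambda>k. \<psi> (Suc k))\<close>, of "{..<n}"] \<psi>_nonneg \<phi>[of n] by simp
  ultimately have "convergent ?d"
    using decseq_convergent[of ?d] by (metis convergentI)
  from convergent_add[OF this conv] show ?thesis
    by simp
qed

text \<open>
  In the application \<open>\<phi> k\<close>, \<open>\<delta> k\<close> and \<open>e k\<close> are the squared seminorms of \<open>w k - p\<close>, of
  \<open>w k - w (k - 1)\<close> and of \<open>w (Suc k) - wbar k\<close>.
\<close>
locale inertial_recursion =
  fixes \<phi> \<delta> e h \<alpha> :: "nat \<Rightarrow> real" and a :: real
  assumes \<phi>_nonneg: "0 \<le> \<phi> k" and \<delta>_nonneg: "0 \<le> \<delta> k" and e_nonneg: "0 \<le> e k" and h_nonneg: "0 \<le> h k"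
    and \<delta>_0: "\<delta> 0 = 0"
    and \<alpha>_nonneg: "0 \<le> \<alpha> k" and \<alpha>_mono: "\<alpha> k \<le> \<alpha> (Suc k)" and \<alpha>_le: "\<alpha> k \<le> a" and a_less: "a < 1 / 3"
    and step: "\<phi> (Suc k) \<le> (1 + \<alpha> k) * \<phi> k - \<alpha> k * \<phi> (k - 1) + \<alpha> k * (1 + \<alpha> k) * \<delta> k - e k - h k"
    and e_ge: "(1 - \<alpha> k) * (\<delta> (Suc k) - \<alpha> k * \<delta> k) \<le> e k"
begin

lemma a_nonneg: "0 \<le> a"
  using \<alpha>_nonneg[of 0] \<alpha>_le[of 0] by simp

definition lyapunov :: "nat \<Rightarrow> real" where
  "lyapunov k = \<phi> k - \<alpha> k * \<phi> (k - 1) + 2 * \<alpha> k * \<delta> k"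

text \<open>Bounding \<open>e k\<close> below by \<open>e_ge\<close> merges the coefficients
  \<open>\<alpha> k * (1 + \<alpha> k)\<close> and \<open>\<alpha> k * (1 - \<alpha> k)\<close> of
  \<open>\<delta> k\<close> into \<open>2 * \<alpha> k\<close>, the weight used in
  \<open>lyapunov\<close>.\<close>

lemma step_delta:
  "\<phi> (Suc k) - \<phi> k \<le> \<alpha> k * (\<phi> k - \<phi> (k - 1)) + 2 * \<alpha> k * \<delta> k - (1 - \<alpha> k) * \<delta> (Suc k) - h k"
  using step[of k] e_ge[of k] by (simp add: algebra_simps)

text \<open>Monotonicity of \<open>\<alpha>\<close> allows the new weight on
  \<open>\<phi> k\<close>. The coefficient left on \<open>\<delta> (Suc k)\<close> is
  \<open>1 - \<alpha> k - 2 * \<alpha> (Suc k)\<close>, at least \<open>1 - 3 * a\<close>; this is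
  the origin of the threshold 1/3.\<close>

lemma lyapunov_Suc: "lyapunov (Suc k) + (1 - 3 * a) * \<delta> (Suc k) + h k \<le> lyapunov k"
proof -
  have "\<alpha> k * \<phi> k \<le> \<alpha> (Suc k) * \<phi> k"
    by (intro mult_right_mono \<alpha>_mono \<phi>_nonneg)
  moreover have "(1 - 3 * a) * \<delta> (Suc k) \<le> (1 - \<alpha> k - 2 * \<alpha> (Suc k)) * \<delta> (Suc k)"
    using \<alpha>_le[of k] \<alpha>_le[of "Suc k"] by (intro mult_right_mono \<delta>_nonneg) linarith
  ultimately show ?thesis
    using step_delta[of k] by (simp add: lyapunov_def algebra_simps)
qed

lemma lyapunov_sum: "lyapunov n + (1 - 3 * a) * (\<Sum>i<n. \<delta> (Suc i)) + (\<Sum>i<n. h i) \<le> \<phi> 0"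
proof (induction n)
  case 0
  \<comment> \<open>Truncated subtraction and \<open>\<delta> 0 = 0\<close> give
    \<open>lyapunov 0 = (1 - \<alpha> 0) * \<phi> 0\<close>.\<close>
  show ?case
    using mult_nonneg_nonneg[OF \<alpha>_nonneg \<phi>_nonneg, of 0 0] by (simp add: lyapunov_def \<delta>_0)
next
  case (Suc n)
  then show ?case
    using lyapunov_Suc[of n] by (simp add: algebra_simps)
qed

lemma phi_le_lyapunov: "\<phi> k - a * \<phi> (k - 1) \<le> lyapunov k"
  using mult_right_mono[OF \<alpha>_le \<phi>_nonneg, of k "k - 1"] mult_nonneg_nonneg[OF \<alpha>_nonneg \<delta>_nonneg, of k k]
  by (simp add: lyapunov_def)

text \<open>Dropping the nonnegative sums leaves
  \<open>\<phi> (Suc n) \<le> a * \<phi> n + \<phi> 0\<close>, and the bound is the fixed point of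
  this affine recursion.\<close>

lemma phi_bound: "\<phi> n \<le> \<phi> 0 / (1 - a)"
proof (induction n)
  case 0
  show ?case
    using a_nonneg a_less \<phi>_nonneg[of 0] by (simp add: field_simps)
next
  case (Suc n)
  have "0 \<le> (1 - 3 * a) * (\<Sum>i<Suc n. \<delta> (Suc i))"
    using a_less by (intro mult_nonneg_nonneg sum_nonneg \<delta>_nonneg) auto
  moreover have "0 \<le> (\<Sum>i<Suc n. h i)"
    by (intro sum_nonneg h_nonneg)
  ultimately have "\<phi> (Suc n) \<le> a * \<phi> n + \<phi> 0"
    using lyapunov_sum[of "Suc n"] phi_le_lyapunov[of "Suc n", unfolded diff_Suc_1] by linarith
  also have "\<dots> \<le> a * (\<phi> 0 / (1 - a)) + \<phi> 0"
    by (intro add_right_mono mult_left_mono Suc.IH a_nonneg)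
  also have "\<dots> = \<phi> 0 / (1 - a)"
    using a_less by (simp add: field_simps)
  finally show ?case .
qed

lemma phi_0_add_bound: "\<phi> 0 + a * \<phi> n \<le> \<phi> 0 / (1 - a)"
proof -
  have "\<phi> 0 + a * \<phi> n \<le> \<phi> 0 + a * (\<phi> 0 / (1 - a))"
    by (intro add_left_mono mult_left_mono phi_bound a_nonneg)
  also have "\<dots> = \<phi> 0 / (1 - a)"
    using a_less by (simp add: field_simps)
  finally show ?thesis .
qed

text \<open>The value \<open>lyapunov n\<close> may be negative, but never below
  \<open>- a * \<phi> (n - 1)\<close>, which \<open>phi_0_add_bound\<close> absorbs.\<close>

lemma sum_delta_h: "(1 - 3 * a) * (\<Sum>i<n. \<delta> (Suc i)) + (\<Sum>i<n. h i) \<le> \<phi> 0 / (1 - a)"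
  using lyapunov_sum[of n] phi_le_lyapunov[of n] phi_0_add_bound[of "n - 1"] \<phi>_nonneg[of n] by linarith

lemma summable_h: "summable h"
proof (rule summableI_nonneg_bounded[OF h_nonneg])
  fix n
  have "0 \<le> (1 - 3 * a) * (\<Sum>i<n. \<delta> (Suc i))"
    using a_less by (intro mult_nonneg_nonneg sum_nonneg \<delta>_nonneg) auto
  then show "(\<Sum>i<n. h i) \<le> \<phi> 0 / (1 - a)"
    using sum_delta_h[of n] by linarith
qed

lemma sum_delta: "(\<Sum>i<n. \<delta> i) \<le> \<phi> 0 / ((1 - a) * (1 - 3 * a))"
proof -
  have "0 \<le> (\<Sum>i<n. h i)"
    by (intro sum_nonneg h_nonneg)
  then have "(1 - 3 * a) * (\<Sum>i<n. \<delta> (Suc i)) \<le> \<phi> 0 / (1 - a)"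
    using sum_delta_h[of n] by linarith
  then have "(\<Sum>i<n. \<delta> (Suc i)) \<le> \<phi> 0 / (1 - a) / (1 - 3 * a)"
    using a_less by (subst pos_le_divide_eq) (simp_all add: mult.commute)
  then have "(\<Sum>i<n. \<delta> (Suc i)) \<le> \<phi> 0 / ((1 - a) * (1 - 3 * a))"
    by simp
  moreover have "(\<Sum>i<n. \<delta> i) \<le> (\<Sum>i<Suc n. \<delta> i)"
    by (simp add: \<delta>_nonneg)
  moreover have "(\<Sum>i<Suc n. \<delta> i) = (\<Sum>i<n. \<delta> (Suc i))"
    by (subst sum.lessThan_Suc_shift) (simp add: \<delta>_0)
  ultimately show ?thesis
    by linarith
qed

lemma convergent_phi: "convergent \<phi>"
proof (rule inertial_convergent[where \<alpha> = \<alpha> and s = "\<lambda>k. 2 * a * \<delta> k" and a = a])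
  show "summable (\<lambda>k. 2 * a * \<delta> k)"
    by (rule summable_mult[OF summableI_nonneg_bounded[OF \<delta>_nonneg sum_delta]])
  show "\<phi> (Suc k) - \<phi> k \<le> \<alpha> k * (\<phi> k - \<phi> (k - 1)) + 2 * a * \<delta> k" for k
  proof -
    have "0 \<le> (1 - \<alpha> k) * \<delta> (Suc k)"
      using \<alpha>_le[of k] a_less by (intro mult_nonneg_nonneg \<delta>_nonneg) auto
    moreover have "\<alpha> k * \<delta> k \<le> a * \<delta> k"
      by (intro mult_right_mono \<alpha>_le \<delta>_nonneg)
    ultimately show ?thesis
      using step_delta[of k] h_nonneg[of k] by linarith
  qed
qed (use a_nonneg a_less \<delta>_nonneg in \<open>auto simp: \<phi>_nonneg \<alpha>_nonneg \<alpha>_le\<close>)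

text \<open>Here \<open>step\<close> is telescoped with \<open>e\<close> retained instead of traded
  for \<open>\<delta>\<close>; the \<open>\<delta>\<close> terms are then controlled by
  \<open>sum_delta\<close>.\<close>

lemma sum_e: "(\<Sum>i<n. e i) \<le> (1 + 2 / (1 - 3 * a)) * \<phi> 0"
proof -
  have "(\<phi> n - \<alpha> n * \<phi> (n - 1)) + (\<Sum>i<n. e i) \<le> \<phi> 0 + (\<Sum>i<n. a * (1 + a) * \<delta> i)" for n
  proof (induction n)
    case 0
    show ?case
      using mult_nonneg_nonneg[OF \<alpha>_nonneg \<phi>_nonneg, of 0 0] by simp
  next
    case (Suc n)
    have "\<alpha> n * \<phi> n \<le> \<alpha> (Suc n) * \<phi> n"
      by (intro mult_right_mono \<alpha>_mono \<phi>_nonneg)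
    moreover have "\<alpha> n * (1 + \<alpha> n) * \<delta> n \<le> a * (1 + a) * \<delta> n"
      using \<alpha>_le[of n] a_nonneg \<alpha>_nonneg[of n] by (intro mult_right_mono mult_mono \<delta>_nonneg) auto
    ultimately show ?case
      using Suc.IH step[of n] h_nonneg[of n] by (simp add: algebra_simps)
  qed
  from this[of n]
  have "(\<Sum>i<n. e i) \<le> \<phi> 0 + a * \<phi> (n - 1) + a * (1 + a) * (\<Sum>i<n. \<delta> i)"
    using mult_right_mono[OF \<alpha>_le \<phi>_nonneg, of n "n - 1"] \<phi>_nonneg[of n]
    by (simp add: sum_distrib_left)
  also have "\<dots> \<le> \<phi> 0 / (1 - a) + a * (1 + a) * (\<phi> 0 / ((1 - a) * (1 - 3 * a)))"
    using a_nonneg by (intro add_mono phi_0_add_bound mult_left_mono sum_delta) auto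
  \<comment> \<open>Over the common denominator the numerator is
    \<open>(1 - 3 * a) + a * (1 + a) = (1 - a)\<^sup>2\<close>, and one factor cancels.\<close>
  also have "\<dots> = (1 - a) / (1 - 3 * a) * \<phi> 0"
    using a_less by (simp add: divide_simps) (simp add: algebra_simps power2_eq_square)
  also have "\<dots> \<le> (1 + 2 / (1 - 3 * a)) * \<phi> 0"
  proof (rule mult_right_mono[OF _ \<phi>_nonneg])
    \<comment> \<open>The stated constant is exactly three times the one just obtained.\<close>
    have "(1 - a) / (1 - 3 * a) \<le> (3 - 3 * a) / (1 - 3 * a)"
      using a_less by (intro divide_right_mono) auto
    also have "\<dots> = 1 + 2 / (1 - 3 * a)"
      using a_less by (simp add: field_simps)
    finally show "(1 - a) / (1 - 3 * a) \<le> 1 + 2 / (1 - 3 * a)" .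
  qed
  finally show ?thesis .
qed

lemma summable_e: "summable e"
  by (rule summableI_nonneg_bounded[OF e_nonneg sum_e])

end

subsection \<open>Running minima of summable sequences\<close>

lemma running_Min_le_average:
  fixes e :: "nat \<Rightarrow> real"
  assumes "0 < k" "(\<Sum>i<k. e i) \<le> C"
  shows "Min (e ` {0..k - 1}) \<le> C / real k"
proof -
  have "real k * Min (e ` {0..k - 1}) = (\<Sum>i<k. Min (e ` {0..k - 1}))"
    by simp
  also have "\<dots> \<le> (\<Sum>i<k. e i)"
    by (intro sum_mono Min_le) auto
  finally show ?thesis
    using assms by (simp add: field_simps)
qed

lemma running_Min_smallo:
  fixes e :: "nat \<Rightarrow> real"
  assumes nonneg: "\<And>i. 0 \<le> e i" and "summable e"
  shows "(\<lambda>k. Min (e ` {0..k - 1})) \<in> o(\<lambda>k. 1 / real k)"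
proof -
  let ?m = "\<lambda>k. Min (e ` {0..k - 1})"
  \<comment> \<open>For \<open>k = 0\<close> the index set is \<open>{0}\<close>, so the minimum is
    always over a nonempty set.\<close>
  have m_nonneg: "0 \<le> ?m k" for k
    using nonneg by (subst Min_ge_iff) auto
  text \<open>The last half of the indices below \<open>k\<close> already carries at least \<open>k / 2 * ?m k\<close>.\<close>
  have bound: "real k * ?m k \<le> 2 * ((\<Sum>i<k. e i) - (\<Sum>i<k div 2. e i))" for k
  proof -
    have "real k \<le> 2 * real (k - k div 2)"
      by linarith
    from mult_right_mono[OF this m_nonneg[of k]]
    have "real k * ?m k \<le> 2 * (real (k - k div 2) * ?m k)"
      by (simp only: mult.assoc)
    also have "real (k - k div 2) * ?m k = (\<Sum>i\<in>{k div 2..<k}. ?m k)"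
      by simp
    also have "\<dots> \<le> (\<Sum>i\<in>{k div 2..<k}. e i)"
      by (intro sum_mono Min_le) auto
    also have "\<dots> = (\<Sum>i<k. e i) - (\<Sum>i<k div 2. e i)"
      using sum_diff_nat_ivl[of 0 "k div 2" k e] by (simp add: atLeast0LessThan)
    finally show ?thesis
      by simp
  qed
  have lim: "(\<lambda>n. \<Sum>i<n. e i) \<longlonglongrightarrow> suminf e"
    by (rule summable_LIMSEQ[OF \<open>summable e\<close>])
  \<comment> \<open>Both partial sums in \<open>bound\<close> then tend to the same limit, so their
    difference vanishes.\<close>
  have "filterlim (\<lambda>k::nat. k div 2) at_top at_top"
    unfolding filterlim_at_top
    by (intro allI eventually_at_top_linorderI) (simp add: less_eq_div_iff_mult_less_eq)
  from filterlim_compose[OF lim this]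
  have "(\<lambda>k. 2 * ((\<Sum>i<k. e i) - (\<Sum>i<k div 2. e i))) \<longlonglongrightarrow> 2 * (suminf e - suminf e)"
    by (intro tendsto_intros lim)
  then have lim0: "(\<lambda>k. 2 * ((\<Sum>i<k. e i) - (\<Sum>i<k div 2. e i))) \<longlonglongrightarrow> 0"
    by simp
  have "norm (real k * ?m k) \<le> 2 * ((\<Sum>i<k. e i) - (\<Sum>i<k div 2. e i))" for k
    using bound[of k] mult_nonneg_nonneg[OF of_nat_0_le_iff m_nonneg, of k k]
    unfolding real_norm_def by linarith
  from Lim_null_comparison[OF always_eventually[OF allI[OF this]] lim0]
  have "(\<lambda>k. real k * ?m k) \<longlonglongrightarrow> 0" .
  then have "(\<lambda>k. ?m k / (1 / real k)) \<longlonglongrightarrow> 0"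
    by (simp add: mult.commute)
  then show ?thesis
    by (rule smalloI_tendsto) (rule eventually_sequentiallyI[of 1], simp)
qed

subsection \<open>The inertial proximal point method\<close>

text \<open>
  The comparison points of the descent estimate. Unlike \<open>mvi_solutions\<close>, this set contains the limit
  points of the iterates even when \<open>F\<close> is discontinuous, since \<open>F\<close> is evaluated at the test point only.
\<close>
definition strong_minty_solutions ::
  "(real ^ 'n) set \<Rightarrow> (real ^ 'n \<Rightarrow> real) \<Rightarrow> (real ^ 'n \<Rightarrow> real ^ 'n) \<Rightarrow> real ^ 'n ^ 'n \<Rightarrow> (real ^ 'n) set"
  where
  "strong_minty_solutions \<Omega> \<theta> F H =
     {p \<in> \<Omega>. \<forall>v\<in>\<Omega>. mat_inner H (v - p) (v - p) \<le> \<theta> v - \<theta> p + (v - p) \<bullet> F v}"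

lemma H_monotone_le:
  assumes "psd_matrix H" "H_monotone H F"
  shows "mat_inner H (u - v) (u - v) + (u - v) \<bullet> F v \<le> (u - v) \<bullet> F u"
  using assms by (simp add: H_monotone_def psd_matrix_norm_power2 inner_diff_right algebra_simps)

text \<open>Replacing \<open>F p\<close> by \<open>F v\<close> through \<open>H\<close>-monotonicity
  gains precisely the \<open>H\<close> term.\<close>

lemma mvi_solutions_subset_strong_minty:
  assumes "psd_matrix H" "H_monotone H F"
  shows "mvi_solutions \<Omega> \<theta> F \<subseteq> strong_minty_solutions \<Omega> \<theta> F H"
proof
  fix p assume p: "p \<in> mvi_solutions \<Omega> \<theta> F"
  have "mat_inner H (v - p) (v - p) \<le> \<theta> v - \<theta> p + (v - p) \<bullet> F v" if "v \<in> \<Omega>" for v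
  proof -
    have "0 \<le> \<theta> v - \<theta> p + (v - p) \<bullet> F p"
      using p that by (simp add: mvi_solutions_def)
    then show ?thesis
      using H_monotone_le[OF assms, of v p] by linarith
  qed
  then show "p \<in> strong_minty_solutions \<Omega> \<theta> F H"
    using p by (simp add: strong_minty_solutions_def mvi_solutions_def)
qed

locale inertial_ppm_run =
  fixes \<Omega> :: "(real ^ 'n) set"
    and \<theta> :: "real ^ 'n \<Rightarrow> real"
    and F :: "real ^ 'n \<Rightarrow> real ^ 'n"
    and G H :: "real ^ 'n ^ 'n"
    and \<alpha> lam :: "nat \<Rightarrow> real"
    and a l :: real
    and w wbar :: "nat \<Rightarrow> real ^ 'n"
  assumes closed_\<Omega>: "closed \<Omega>"
    and \<theta>: "closed_proper_convex \<theta>"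
    and G: "psd_matrix G" and H: "psd_matrix H"
    and F: "H_monotone H F"
    and GH: "pd_matrix (G + H)"
    and \<alpha>_nonneg: "0 \<le> \<alpha> k" and \<alpha>_mono: "\<alpha> k \<le> \<alpha> (Suc k)" and \<alpha>_le: "\<alpha> k \<le> a" and a_less: "a < 1 / 3"
    and l_pos: "0 < l" and lam_ge: "l \<le> lam k"
    and run: "inertial_ppm \<Omega> \<theta> F G \<alpha> lam w wbar"
begin

lemma wbar: "wbar k = w k + \<alpha> k *\<^sub>R (w k - w (k - 1))"
  using run by (simp add: inertial_ppm_def)

lemma w_Suc_in: "w (Suc k) \<in> \<Omega>"
  using run by (simp add: inertial_ppm_def)

lemma proximal_inequality:
  assumes "v \<in> \<Omega>"
  shows "0 \<le> \<theta> v - \<theta> (w (Suc k)) + (v - w (Suc k)) \<bullet> F (w (Suc k)) +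
    inverse (lam k) * mat_inner G (v - w (Suc k)) (w (Suc k) - wbar k)"
proof -
  have "0 \<le> \<theta> v - \<theta> (w (Suc k)) +
      (v - w (Suc k)) \<bullet> (F (w (Suc k)) + inverse (lam k) *\<^sub>R (G *v (w (Suc k) - wbar k)))"
    using run assms unfolding inertial_ppm_def by blast
  then show ?thesis
    by (simp only: inner_add_right inner_scaleR_right mat_inner_def add.assoc)
qed

text \<open>The proximal inequality tested at \<open>p\<close>, added to the Minty inequality of
  \<open>p\<close> tested at \<open>w (Suc k)\<close>, cancels every \<open>\<theta>\<close> and
  \<open>F\<close> term. Goals 10 and 11 are the assumptions \<open>step\<close> and
  \<open>e_ge\<close>.\<close>

lemma recursion:
  assumes p: "p \<in> strong_minty_solutions \<Omega> \<theta> F H"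
  shows "inertial_recursion
    (\<lambda>k. mat_inner G (w k - p) (w k - p))
    (\<lambda>k. mat_inner G (w k - w (k - 1)) (w k - w (k - 1)))
    (\<lambda>k. mat_inner G (w (Suc k) - wbar k) (w (Suc k) - wbar k))
    (\<lambda>k. 2 * l * mat_inner H (w (Suc k) - p) (w (Suc k) - p)) \<alpha> a"
proof (unfold_locales, goal_cases)
  case (10 k)
  let ?d = "w (Suc k)"
  let ?h = "mat_inner H (?d - p) (?d - p)"
  let ?g = "mat_inner G (p - ?d) (?d - wbar k)"
  have "p \<in> \<Omega>"
    using p by (simp add: strong_minty_solutions_def)
  moreover have "?h \<le> \<theta> ?d - \<theta> p + (?d - p) \<bullet> F ?d"
    using p w_Suc_in by (simp add: strong_minty_solutions_def)
  moreover have "(?d - p) \<bullet> F ?d = - ((p - ?d) \<bullet> F ?d)"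
    by (simp flip: inner_minus_left)
  ultimately have "?h \<le> inverse (lam k) * ?g"
    using proximal_inequality[of p k] by linarith
  then have "lam k * ?h \<le> ?g"
    using l_pos lam_ge[of k] by (simp add: field_simps)
  \<comment> \<open>Passing from \<open>lam k\<close> to its lower bound gives the \<open>H\<close>
    terms a fixed weight, so their summability survives removing it.\<close>
  moreover have "l * ?h \<le> lam k * ?h"
    by (intro mult_right_mono lam_ge psd_matrix_nonneg H)
  ultimately have "2 * l * ?h \<le> 2 * ?g"
    by linarith
  then show ?case
    unfolding mat_inner_polarization[OF G] mat_inner_extrapolation[OF G wbar] by simp
next
  case (11 k)
  show ?case
    using mat_inner_extrapolation_ge[OF G wbar \<alpha>_nonneg] by simp
qed (use G H l_pos a_less in \<open>auto simp: psd_matrix_nonneg \<alpha>_nonneg \<alpha>_mono \<alpha>_le mat_inner_zero_left\<close>)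

lemma summable_residual:
  assumes "p \<in> strong_minty_solutions \<Omega> \<theta> F H"
  shows "summable (\<lambda>k. mat_inner G (w (Suc k) - wbar k) (w (Suc k) - wbar k))"
  by (rule inertial_recursion.summable_e[OF recursion[OF assms]])

text \<open>The \<open>G\<close> part converges by the recursion and the \<open>H\<close> part tends
  to zero by summability. Their sum is what is needed, since definiteness is only known for
  \<open>G + H\<close>.\<close>

lemma convergent_distance:
  assumes p: "p \<in> strong_minty_solutions \<Omega> \<theta> F H"
  obtains L where "(\<lambda>k. mat_inner (G + H) (w k - p) (w k - p)) \<longlonglongrightarrow> L"
proof -
  interpret inertial_recursion
    "\<lambda>k. mat_inner G (w k - p) (w k - p)"
    "\<lambda>k. mat_inner G (w k - w (k - 1)) (w k - w (k - 1))"
    "\<lambda>k. mat_inner G (w (Suc k) - wbar k) (w (Suc k) - wbar k)"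
    "\<lambda>k. 2 * l * mat_inner H (w (Suc k) - p) (w (Suc k) - p)" \<alpha> a
    by (rule recursion[OF p])
  obtain L where L: "(\<lambda>k. mat_inner G (w k - p) (w k - p)) \<longlonglongrightarrow> L"
    using convergent_phi by (auto simp: convergent_def)
  have "(\<lambda>k. 2 * l * mat_inner H (w (Suc k) - p) (w (Suc k) - p)) \<longlonglongrightarrow> 0"
    by (rule summable_LIMSEQ_zero[OF summable_h])
  then have "(\<lambda>k. mat_inner H (w (Suc k) - p) (w (Suc k) - p)) \<longlonglongrightarrow> 0"
    using l_pos by (subst (asm) tendsto_mult_left_iff[where l = 0, simplified]) auto
  then have "(\<lambda>k. mat_inner H (w k - p) (w k - p)) \<longlonglongrightarrow> 0"
    by (rule LIMSEQ_imp_Suc)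
  from tendsto_add[OF L this] show thesis
    by (intro that) (simp add: mat_inner_matrix_add)
qed

lemma bounded_iterates:
  assumes p: "p \<in> strong_minty_solutions \<Omega> \<theta> F H"
  shows "bounded (range w)"
proof -
  obtain c where c: "c > 0" "\<And>x. c * (norm x)\<^sup>2 \<le> mat_inner (G + H) x x"
    using pd_matrix_coercive[OF GH] by blast
  obtain L where "(\<lambda>k. mat_inner (G + H) (w k - p) (w k - p)) \<longlonglongrightarrow> L"
    using convergent_distance[OF p] .
  then have "Bseq (\<lambda>k. mat_inner (G + H) (w k - p) (w k - p))"
    by (intro convergent_imp_Bseq convergentI)
  then obtain K where K: "\<bar>mat_inner (G + H) (w k - p) (w k - p)\<bar> \<le> K" for k
    by (auto simp: Bseq_def)
  have "norm (w k - p) \<le> sqrt (K / c)" for k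
  proof (rule real_le_rsqrt)
    have "c * (norm (w k - p))\<^sup>2 \<le> K"
      using c(2)[of "w k - p"] K[of k] by linarith
    then show "(norm (w k - p))\<^sup>2 \<le> K / c"
      using c(1) by (simp add: field_simps)
  qed
  then show ?thesis
    by (auto simp: bounded_def dist_norm norm_minus_commute)
qed

text \<open>The residual is only known to vanish in the \<open>G\<close> seminorm, so Cauchy-Schwarz
  is applied in that seminorm, where the distances from the iterates to \<open>v\<close> stay
  bounded.\<close>

lemma residual_term_tendsto_0:
  assumes p: "p \<in> strong_minty_solutions \<Omega> \<theta> F H"
  shows "(\<lambda>k. inverse (lam k) * mat_inner G (v - w (Suc k)) (w (Suc k) - wbar k)) \<longlonglongrightarrow> 0"
proof -
  interpret inertial_recursion
    "\<lambda>k. mat_inner G (w k - p) (w k - p)"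
    "\<lambda>k. mat_inner G (w k - w (k - 1)) (w k - w (k - 1))"
    "\<lambda>k. mat_inner G (w (Suc k) - wbar k) (w (Suc k) - wbar k)"
    "\<lambda>k. 2 * l * mat_inner H (w (Suc k) - p) (w (Suc k) - p)" \<alpha> a
    by (rule recursion[OF p])
  define C where "C = 2 * mat_inner G (v - p) (v - p) + 2 * (mat_inner G (w 0 - p) (w 0 - p) / (1 - a))"
  let ?e = "\<lambda>k. mat_inner G (w (Suc k) - wbar k) (w (Suc k) - wbar k)"
  have C: "mat_inner G (v - w k) (v - w k) \<le> C" for k
    using psd_matrix_diff_le[OF G, of "v - p" "w k - p"] phi_bound[of k] by (simp add: C_def)
  have bound: "\<bar>inverse (lam k) * mat_inner G (v - w (Suc k)) (w (Suc k) - wbar k)\<bar>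
      \<le> inverse l * sqrt (C * ?e k)" for k
  proof -
    have "(mat_inner G (v - w (Suc k)) (w (Suc k) - wbar k))\<^sup>2
        \<le> mat_inner G (v - w (Suc k)) (v - w (Suc k)) * ?e k"
      by (rule psd_matrix_Cauchy_Schwarz[OF G])
    also have "\<dots> \<le> C * ?e k"
      by (intro mult_right_mono C psd_matrix_nonneg G)
    finally have "\<bar>mat_inner G (v - w (Suc k)) (w (Suc k) - wbar k)\<bar> \<le> sqrt (C * ?e k)"
      by (intro real_le_rsqrt) simp
    then show ?thesis
      unfolding abs_mult using l_pos lam_ge[of k]
      by (intro mult_mono) (auto intro: le_imp_inverse_le)
  qed
  have "(\<lambda>k. inverse l * sqrt (C * ?e k)) \<longlonglongrightarrow> inverse l * sqrt (C * 0)"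
    by (intro tendsto_intros summable_LIMSEQ_zero[OF summable_e])
  then have "(\<lambda>k. inverse l * sqrt (C * ?e k)) \<longlonglongrightarrow> 0"
    by simp
  then show ?thesis
    by (rule Lim_null_comparison[rotated]) (use bound in auto)
qed

section \<open>Limit points of the iterates and convergence of the whole sequence\<close>

lemma isCont_\<theta>: "isCont \<theta> x"
  using convex_on_continuous[of UNIV \<theta>] \<theta>
  by (simp add: closed_proper_convex_def continuous_on_eq_continuous_at)

lemma subsequential_limit_strong_minty:
  assumes p: "p \<in> strong_minty_solutions \<Omega> \<theta> F H"
    and r: "strict_mono r" "(\<lambda>n. w (Suc (r n))) \<longlonglongrightarrow> q"
  shows "q \<in> strong_minty_solutions \<Omega> \<theta> F H"
proof -
  let ?t = "\<lambda>v k. inverse (lam k) * mat_inner G (v - w (Suc k)) (w (Suc k) - wbar k)"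
  have "q \<in> \<Omega>"
    using closed_sequentially[OF closed_\<Omega> _ r(2)] w_Suc_in by simp
  moreover have "mat_inner H (v - q) (v - q) \<le> \<theta> v - \<theta> q + (v - q) \<bullet> F v" if v: "v \<in> \<Omega>" for v
  proof -
    \<comment> \<open>Monotonicity moves \<open>F\<close> from the iterate to the fixed point
      \<open>v\<close> before the limit is taken, so no continuity of \<open>F\<close> is
      involved.\<close>
    have le: "mat_inner H (v - w (Suc k)) (v - w (Suc k))
        \<le> \<theta> v - \<theta> (w (Suc k)) + (v - w (Suc k)) \<bullet> F v + ?t v k" for k
      using proximal_inequality[OF v, of k] H_monotone_le[OF H F, of v "w (Suc k)"] by linarith
    have lhs: "(\<lambda>n. mat_inner H (v - w (Suc (r n))) (v - w (Suc (r n)))) \<longlonglongrightarrow> mat_inner H (v - q) (v - q)"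
      by (intro tendsto_intros r)
    have "(\<lambda>n. \<theta> v - \<theta> (w (Suc (r n))) + (v - w (Suc (r n))) \<bullet> F v + ?t v (r n))
        \<longlonglongrightarrow> \<theta> v - \<theta> q + (v - q) \<bullet> F v + 0"
      by (intro tendsto_intros r isCont_tendsto_compose[OF isCont_\<theta> r(2)]
          LIMSEQ_subseq_LIMSEQ[OF residual_term_tendsto_0[OF p] r(1), unfolded o_def])
    from LIMSEQ_le[OF lhs this] le show ?thesis
      by simp
  qed
  ultimately show ?thesis
    by (simp add: strong_minty_solutions_def)
qed

text \<open>An Opial-type argument: the distance to a cluster point \<open>q\<close> converges along
  the whole sequence and tends to zero along a subsequence, hence tends to zero.\<close>

lemma iterates_converge:
  assumes p: "p \<in> strong_minty_solutions \<Omega> \<theta> F H"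
  obtains q where "w \<longlonglongrightarrow> q"
proof -
  \<comment> \<open>The shift by one keeps the sequence inside \<open>\<Omega>\<close>, where
    \<open>w 0\<close> need not lie.\<close>
  have "bounded (range (\<lambda>k. w (Suc k)))"
    using bounded_iterates[OF p] by (rule bounded_subset) auto
  then obtain q r where r: "strict_mono r" "(\<lambda>n. w (Suc (r n))) \<longlonglongrightarrow> q"
    using bounded_imp_convergent_subsequence unfolding o_def by blast
  have "q \<in> strong_minty_solutions \<Omega> \<theta> F H"
    by (rule subsequential_limit_strong_minty[OF p r])
  then obtain L where L: "(\<lambda>k. mat_inner (G + H) (w k - q) (w k - q)) \<longlonglongrightarrow> L"
    using convergent_distance by blast
  have "strict_mono (\<lambda>n. Suc (r n))"
    using r(1) by (simp add: strict_mono_def)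
  from LIMSEQ_subseq_LIMSEQ[OF L this]
  have "(\<lambda>n. mat_inner (G + H) (w (Suc (r n)) - q) (w (Suc (r n)) - q)) \<longlonglongrightarrow> L"
    by (simp add: o_def)
  moreover have "(\<lambda>n. mat_inner (G + H) (w (Suc (r n)) - q) (w (Suc (r n)) - q))
      \<longlonglongrightarrow> mat_inner (G + H) (q - q) (q - q)"
    by (intro tendsto_intros r)
  ultimately have "L = 0"
    using LIMSEQ_unique by (fastforce simp: mat_inner_def)
  obtain c where c: "c > 0" "\<And>x. c * (norm x)\<^sup>2 \<le> mat_inner (G + H) x x"
    using pd_matrix_coercive[OF GH] by blast
  have "(\<lambda>k. (norm (w k - q))\<^sup>2) \<longlonglongrightarrow> 0"
  proof (rule Lim_null_comparison)
    show "\<forall>\<^sub>F k in sequentially. norm ((norm (w k - q))\<^sup>2) \<le> mat_inner (G + H) (w k - q) (w k - q) / c"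
      using c by (intro always_eventually) (simp add: field_simps)
    show "(\<lambda>k. mat_inner (G + H) (w k - q) (w k - q) / c) \<longlonglongrightarrow> 0"
      using tendsto_divide[OF L tendsto_const, of c] c(1) \<open>L = 0\<close> by simp
  qed
  then have "w \<longlonglongrightarrow> q"
    by (simp add: LIM_zero_iff tendsto_norm_zero_iff)
  then show thesis
    by (rule that)
qed

text \<open>Continuity lets \<open>F (w (Suc k))\<close> tend to \<open>F q\<close>, so the proximal
  inequality itself passes to the limit and yields the original variational inequality, not only its
  Minty form.\<close>

lemma limit_mvi_solution:
  assumes p: "p \<in> strong_minty_solutions \<Omega> \<theta> F H"
    and lim: "w \<longlonglongrightarrow> q" and cont: "continuous_on \<Omega> F"
  shows "q \<in> mvi_solutions \<Omega> \<theta> F"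
proof -
  have lim': "(\<lambda>k. w (Suc k)) \<longlonglongrightarrow> q"
    by (rule LIMSEQ_Suc[OF lim])
  have "q \<in> \<Omega>"
    using closed_sequentially[OF closed_\<Omega> _ lim'] w_Suc_in by simp
  have F_lim: "(\<lambda>k. F (w (Suc k))) \<longlonglongrightarrow> F q"
    using continuous_on_tendsto_compose[OF cont lim' \<open>q \<in> \<Omega>\<close>] w_Suc_in by simp
  have "0 \<le> \<theta> v - \<theta> q + (v - q) \<bullet> F q" if v: "v \<in> \<Omega>" for v
  proof -
    have "(\<lambda>k. \<theta> v - \<theta> (w (Suc k)) + (v - w (Suc k)) \<bullet> F (w (Suc k)) +
        inverse (lam k) * mat_inner G (v - w (Suc k)) (w (Suc k) - wbar k))
        \<longlonglongrightarrow> \<theta> v - \<theta> q + (v - q) \<bullet> F q + 0"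
      by (intro tendsto_intros F_lim lim' isCont_tendsto_compose[OF isCont_\<theta> lim']
          residual_term_tendsto_0[OF p])
    from LIMSEQ_le_const[OF this, of 0] proximal_inequality[OF v] show ?thesis
      by simp
  qed
  with \<open>q \<in> \<Omega>\<close> show ?thesis
    by (simp add: mvi_solutions_def)
qed

end

text \<open>Membership of the limit in the solution set is asserted under continuity of
  \<open>F\<close> on \<open>\<Omega>\<close>; in general the argument yields only a strong Minty
  solution. Convergence and both residual rates carry no such condition.\<close>

theorem theorem2:
  fixes \<Omega> :: "(real ^ 'n) set"
    and \<theta> :: "real ^ 'n \<Rightarrow> real"
    and F :: "real ^ 'n \<Rightarrow> real ^ 'n"
    and G H :: "real ^ 'n ^ 'n"
    and \<alpha> lam :: "nat \<Rightarrow> real"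
    and \<alpha>max lammin :: real
    and w wbar :: "nat \<Rightarrow> real ^ 'n"
  assumes "closed \<Omega>" and "convex \<Omega>"
    and "closed_proper_convex \<theta>"
    and "monotone_operator F"
    and "psd_matrix G"
    and "mvi_solutions \<Omega> \<theta> F \<noteq> {}"
    and "psd_matrix H" and "H_monotone H F"
    and "pd_matrix (G + H)"
    and "\<And>k. 0 \<le> \<alpha> k" and "\<And>k. \<alpha> k \<le> \<alpha> (Suc k)" and "\<And>k. \<alpha> k \<le> \<alpha>max" and "\<alpha>max < 1 / 3"
    and "0 < lammin" and "\<And>k. lammin \<le> lam k"
    and "inertial_ppm \<Omega> \<theta> F G \<alpha> lam w wbar"
  shows "(\<exists>w_lim. w \<longlonglongrightarrow> w_lim \<and> (continuous_on \<Omega> F \<longrightarrow> w_lim \<in> mvi_solutions \<Omega> \<theta> F)) \<and>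
    (\<forall>ws\<in>mvi_solutions \<Omega> \<theta> F. \<forall>k\<ge>1.
       Min ((\<lambda>i. (mat_norm G (w (Suc i) - wbar i))\<^sup>2) ` {0..k - 1})
         \<le> (1 + 2 / (1 - 3 * \<alpha>max)) * (mat_norm G (w 0 - ws))\<^sup>2 / real k) \<and>
    (\<lambda>k. Min ((\<lambda>i. (mat_norm G (w (Suc i) - wbar i))\<^sup>2) ` {0..k - 1})) \<in> o(\<lambda>k. 1 / real k)"
proof -
  interpret inertial_ppm_run \<Omega> \<theta> F G H \<alpha> lam \<alpha>max lammin w wbar
    by unfold_locales (use assms in auto)
  let ?e = "\<lambda>i. mat_inner G (w (Suc i) - wbar i) (w (Suc i) - wbar i)"
  have minty: "ws \<in> strong_minty_solutions \<Omega> \<theta> F H" if "ws \<in> mvi_solutions \<Omega> \<theta> F" for ws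
    using mvi_solutions_subset_strong_minty[OF H F] that by blast
  obtain p where p: "p \<in> strong_minty_solutions \<Omega> \<theta> F H"
    using assms(6) minty by blast
  obtain q where "w \<longlonglongrightarrow> q"
    using iterates_converge[OF p] .
  then have "\<exists>w_lim. w \<longlonglongrightarrow> w_lim \<and> (continuous_on \<Omega> F \<longrightarrow> w_lim \<in> mvi_solutions \<Omega> \<theta> F)"
    using limit_mvi_solution[OF p] by blast
  moreover have "Min (?e ` {0..k - 1})
      \<le> (1 + 2 / (1 - 3 * \<alpha>max)) * mat_inner G (w 0 - ws) (w 0 - ws) / real k"
    if "ws \<in> mvi_solutions \<Omega> \<theta> F" "k \<ge> 1" for ws k
    \<comment> \<open>Every solution is itself a valid comparison point, so \<open>sum_e\<close>
      applies with \<open>ws\<close> in place of the fixed \<open>p\<close>.\<close>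
    using running_Min_le_average[OF _ inertial_recursion.sum_e[OF recursion[OF minty]]] that by simp
  moreover have "(\<lambda>k. Min (?e ` {0..k - 1})) \<in> o(\<lambda>k. 1 / real k)"
    by (intro running_Min_smallo psd_matrix_nonneg G summable_residual[OF p])
  ultimately show ?thesis
    unfolding psd_matrix_norm_power2[OF G] by blast
qed

end
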